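(* Let $n$ be an odd positive integer and let $P_n$ be the path on $n$ vertices. Then $\gamma'_{\rm SMB}(P_n)=\lfloor \log_2 n\rfloor+1$. Moreover, Staller has a strategy in the S-game on $P_n$ which, against every strategy of Dominator, wins after she has played at most $\lfloor \log_2 n\rfloor+1$ vertices, such that the closed neighborhood she claims is $N[v]$ for a vertex $v$ at even distance from the ends of the path.
   Context: All graphs are finite and simple; $N_G[v]=N_G(v)\cup\{v\}$ is the closed neighborhood of $v$. The Maker-Breaker domination game on a graph $G$ is played by two players, Dominator and Staller, who alternately choose (play) a vertex of $G$ that has not been played before. Dominator wins if the set of vertices he has played is a dominating set of $G$; Staller wins (claims $N_G[v]$) if she has played all vertices of $N_G[v]$ for some vertex $v\in V(G)$. In the S-game Staller makes the first move. $\gamma'_{\rm SMB}(G)$ is the smallest integer $k$ such that in the S-game, under any strategy of Dominator, Staller can win having played at most $k$ vertices ($\infty$ if Staller has no winning strategy). *)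

theory Defs
  imports Complex_Main "HOL-Library.Extended_Nat" "Graph_Theory.Graph_Theory"
begin

text \<open>
  Finite simple graphs are the \<^locale>\<open>pair_graph\<close>s of Graph_Theory: an edge \<open>uv\<close> is the pair of
  arcs \<open>(u, v)\<close>, \<open>(v, u)\<close>.
\<close>

definition path_graph :: "nat \<Rightarrow> nat pair_pre_digraph" where
  "path_graph n =
     \<lparr> pverts = {1..n},
       parcs = {(i, j). i \<in> {1..n} \<and> j \<in> {1..n} \<and> (j = i + 1 \<or> i = j + 1)} \<rparr>"

lemma pair_graph_path_graph: "pair_graph (path_graph n)"
proof -
  have "finite (parcs (path_graph n))"
    by (rule finite_subset[of _ "{1..n} \<times> {1..n}"]) (auto simp: path_graph_def)
  then show ?thesis
    by unfold_locales (auto simp: path_graph_def symmetric_def sym_def)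
qed

definition closed_nbhd :: "'a pair_pre_digraph \<Rightarrow> 'a \<Rightarrow> 'a set" where
  "closed_nbhd G v = insert v {u. (v, u) \<in> parcs G}"

definition dominating :: "'a pair_pre_digraph \<Rightarrow> 'a set \<Rightarrow> bool" where
  "dominating G D \<longleftrightarrow> D \<subseteq> pverts G \<and> (\<forall>v\<in>pverts G. closed_nbhd G v \<inter> D \<noteq> {})"

text \<open>Meaningful for vertices in the same component only.\<close>
definition graph_dist :: "'a pair_pre_digraph \<Rightarrow> 'a \<Rightarrow> 'a \<Rightarrow> nat" where
  "graph_dist G u v =
     (LEAST d. \<exists>p. vwalk p (with_proj G) \<and> hd p = u \<and> last p = v \<and> vwalk_length p = d)"

text \<open>
  A history is the list of all vertices played so far, in chronological order. In the S-game the
  moves at positions \<open>0, 2, 4, \<dots>\<close> are Staller's, those at \<open>1, 3, 5, \<dots>\<close> are Dominator's.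
  A strategy of either player maps histories to moves; its value is constrained on all histories
  with an unplayed vertex left, but only the ones where the player is to move matter.
\<close>

definition staller_verts :: "'a list \<Rightarrow> 'a set" where
  "staller_verts h = {h ! i | i. i < length h \<and> even i}"

definition dominator_verts :: "'a list \<Rightarrow> 'a set" where
  "dominator_verts h = {h ! i | i. i < length h \<and> odd i}"

definition strategy :: "'a pair_pre_digraph \<Rightarrow> ('a list \<Rightarrow> 'a) \<Rightarrow> bool" where
  "strategy G s \<longleftrightarrow>
     (\<forall>h. distinct h \<and> set h \<subset> pverts G \<longrightarrow> s h \<in> pverts G - set h)"

text \<open>The first \<open>m\<close> moves when Staller follows \<open>\<sigma>\<close> and Dominator follows \<open>\<tau>\<close>.\<close>
primrec s_play :: "('a list \<Rightarrow> 'a) \<Rightarrow> ('a list \<Rightarrow> 'a) \<Rightarrow> nat \<Rightarrow> 'a list" where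
  "s_play \<sigma> \<tau> 0 = []"
| "s_play \<sigma> \<tau> (Suc m) =
     (let h = s_play \<sigma> \<tau> m in h @ [if even m then \<sigma> h else \<tau> h])"

definition claimed :: "'a pair_pre_digraph \<Rightarrow> 'a list \<Rightarrow> 'a set" where
  "claimed G h = {v \<in> pverts G. closed_nbhd G v \<subseteq> staller_verts h}"

definition game_over :: "'a pair_pre_digraph \<Rightarrow> 'a list \<Rightarrow> bool" where
  "game_over G h \<longleftrightarrow> dominating G (dominator_verts h) \<or> claimed G h \<noteq> {}"

text \<open>The game ends with a win of Staller right after the \<open>m\<close>-th move.\<close>
definition staller_wins_at ::
  "'a pair_pre_digraph \<Rightarrow> ('a list \<Rightarrow> 'a) \<Rightarrow> ('a list \<Rightarrow> 'a) \<Rightarrow> nat \<Rightarrow> bool" where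
  "staller_wins_at G \<sigma> \<tau> m \<longleftrightarrow>
     m \<le> card (pverts G) \<and> claimed G (s_play \<sigma> \<tau> m) \<noteq> {} \<and>
     (\<forall>j<m. \<not> game_over G (s_play \<sigma> \<tau> j))"

definition staller_can_win_within :: "'a pair_pre_digraph \<Rightarrow> nat \<Rightarrow> bool" where
  "staller_can_win_within G k \<longleftrightarrow>
     (\<exists>\<sigma>. strategy G \<sigma> \<and>
        (\<forall>\<tau>. strategy G \<tau> \<longrightarrow>
           (\<exists>m. staller_wins_at G \<sigma> \<tau> m \<and> card (staller_verts (s_play \<sigma> \<tau> m)) \<le> k)))"

text \<open>The infimum of the empty set is \<open>\<infinity>\<close>.\<close>
definition gamma_SMB' :: "'a pair_pre_digraph \<Rightarrow> enat" where
  "gamma_SMB' G = (INF k \<in> {k. staller_can_win_within G k}. enat k)"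

end

theory Submission
  imports Defs
begin

text \<open>
  Staller keeps an interval whose ends are even vertices of her own (or the positions \<open>0\<close> and
  \<open>n + 1\<close>) and whose interior is unplayed. Playing an even vertex near the middle splits it into
  two such intervals, and Dominator can spoil only one, so the number \<open>q\<close> of odd vertices inside
  is replaced by at most \<open>\<lceil>q / 2\<rceil>\<close>; when \<open>q = 1\<close> she takes the odd vertex and wins.
  Conversely, when Staller splits the only dangerous interval, Dominator answers next to her move
  inside the smaller part, and what is left there can be paired off into adjacent vertices. A move
  at an odd vertex of an interval with \<open>q > 1\<close> lets him pair off the whole interval. Hence \<open>q\<close> is
  at most halved by each move, while it starts as \<open>(n + 1) / 2\<close> and has to reach \<open>1\<close>.
\<close>

section \<open>Plays\<close>

lemma staller_verts_Nil [simp]: "staller_verts [] = {}"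
  by (simp add: staller_verts_def)

lemma dominator_verts_Nil [simp]: "dominator_verts [] = {}"
  by (simp add: dominator_verts_def)

lemma staller_verts_snoc:
  "staller_verts (h @ [x]) = (if even (length h) then insert x (staller_verts h) else staller_verts h)"
proof -
  have "(\<exists>i<Suc (length h). even i \<and> v = (h @ [x]) ! i) \<longleftrightarrow>
      even (length h) \<and> v = x \<or> (\<exists>i<length h. even i \<and> v = h ! i)" for v
    unfolding Ex_less_Suc by (auto simp: nth_append)
  then show ?thesis
    unfolding staller_verts_def by auto
qed

lemma dominator_verts_snoc:
  "dominator_verts (h @ [x]) =
     (if even (length h) then dominator_verts h else insert x (dominator_verts h))"
proof -
  have "(\<exists>i<Suc (length h). odd i \<and> v = (h @ [x]) ! i) \<longleftrightarrow>
      odd (length h) \<and> v = x \<or> (\<exists>i<length h. odd i \<and> v = h ! i)" for v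
    unfolding Ex_less_Suc by (auto simp: nth_append)
  then show ?thesis
    unfolding dominator_verts_def by auto
qed

lemma set_eq_staller_Un_dominator: "set h = staller_verts h \<union> dominator_verts h"
  by (induction h rule: rev_induct) (auto simp: staller_verts_snoc dominator_verts_snoc)

lemma staller_Int_dominator: "distinct h \<Longrightarrow> staller_verts h \<inter> dominator_verts h = {}"
  unfolding staller_verts_def dominator_verts_def
  by (auto simp: nth_eq_iff_index_eq)

lemma finite_staller_verts: "finite (staller_verts h)"
  using set_eq_staller_Un_dominator[of h] by (metis List.finite_set finite_Un)

lemma card_staller_verts:
  "distinct h \<Longrightarrow> card (staller_verts h) = (length h + 1) div 2"
proof (induction h rule: rev_induct)
  case (snoc x h)
  then have "x \<notin> staller_verts h"
    using set_eq_staller_Un_dominator[of h] by auto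
  with snoc show ?case
    by (auto simp: staller_verts_snoc finite_staller_verts)
qed simp

lemma length_s_play [simp]: "length (s_play \<sigma> \<tau> m) = m"
  by (induction m) (auto simp: Let_def)

text \<open>A strategy is constrained only while some vertex is unplayed; a play of fewer than
  \<open>card (pverts G)\<close> moves always leaves one, so legality propagates up to that
  length.\<close>

lemma s_play_legal:
  assumes "finite (pverts G)" "strategy G \<sigma>" "strategy G \<tau>" "m \<le> card (pverts G)"
  shows "distinct (s_play \<sigma> \<tau> m) \<and> set (s_play \<sigma> \<tau> m) \<subseteq> pverts G"
  using assms(4)
proof (induction m)
  case (Suc m)
  let ?h = "s_play \<sigma> \<tau> m"
  have IH: "distinct ?h" "set ?h \<subseteq> pverts G"
    using Suc by auto
  moreover have "card (set ?h) = m"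
    using IH by (simp add: distinct_card)
  ultimately have "set ?h \<subset> pverts G"
    using Suc.prems by (metis Suc_n_not_le_n psubsetI)
  then have "\<sigma> ?h \<in> pverts G - set ?h" "\<tau> ?h \<in> pverts G - set ?h"
    using IH assms unfolding strategy_def by blast+
  then show ?case
    using IH by (auto simp: Let_def)
qed simp

section \<open>Paths\<close>

lemma pverts_path_graph [simp]: "pverts (path_graph n) = {1..n}"
  by (simp add: path_graph_def)

lemma mem_closed_nbhd_path_graph:
  assumes "v \<in> {1..n}"
  shows "u \<in> closed_nbhd (path_graph n) v \<longleftrightarrow> 1 \<le> u \<and> u \<le> n \<and> u \<le> v + 1 \<and> v \<le> u + 1"
  using assms unfolding closed_nbhd_def path_graph_def by auto

text \<open>Each step along the path changes the parity of the vertex.\<close>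

lemma vwalk_path_graph_parity:
  assumes "vwalk p (with_proj (path_graph n))"
  shows "even (vwalk_length p) \<longleftrightarrow> even (hd p + last p)"
  using assms
proof (induction rule: vwalk_induct)
  case (Cons u v p)
  then have "v = u + 1 \<or> u = v + 1"
    by (auto simp: path_graph_def)
  with Cons.IH show ?case by auto
qed simp

lemma vwalk_path_graph_upt:
  assumes "1 \<le> u" "u \<le> v" "v \<le> n"
  shows "vwalk [u..<Suc v] (with_proj (path_graph n))"
  using assms(2,1)
proof (induction u rule: inc_induct)
  case base
  then show ?case using assms by (auto simp: vwalk_def)
next
  case (step k)
  have "[k..<Suc v] = k # [Suc k..<Suc v]"
    using step by (simp add: upt_conv_Cons del: upt_Suc)
  moreover have "hd [Suc k..<Suc v] = Suc k"
    using step by (simp add: upt_conv_Cons del: upt_Suc)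
  ultimately show ?case
    using step assms by (auto intro!: vwalk_consI simp: path_graph_def simp del: upt_Suc)
qed

lemma vwalk_path_graph_downto:
  assumes "1 \<le> u" "u \<le> v" "v \<le> n"
  shows "vwalk (rev [u..<Suc v]) (with_proj (path_graph n))"
  using assms(2,3)
proof (induction v rule: dec_induct)
  case base
  then show ?case using assms by (auto simp: vwalk_def)
next
  case (step k)
  have "rev [u..<Suc (Suc k)] = Suc k # rev [u..<Suc k]"
    using step by simp
  moreover have "hd (rev [u..<Suc k]) = k"
    using step by simp
  ultimately show ?case
    using step assms by (auto intro!: vwalk_consI simp: path_graph_def simp del: upt_Suc)
qed

text \<open>All walks between two given vertices have lengths of the same parity. It remains to see
  that the \<open>LEAST\<close> is attained, for which the monotone walks are exhibited.\<close>

lemma even_graph_dist_path_graph: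
  assumes "u \<in> {1..n}" "v \<in> {1..n}"
  shows "even (graph_dist (path_graph n) u v) \<longleftrightarrow> even (u + v)"
proof -
  let ?W = "\<lambda>d. \<exists>p. vwalk p (with_proj (path_graph n)) \<and> hd p = u \<and> last p = v \<and> vwalk_length p = d"
  have "\<exists>p. vwalk p (with_proj (path_graph n)) \<and> hd p = u \<and> last p = v"
  proof (cases "u \<le> v")
    case True
    then have "hd [u..<Suc v] = u" "last [u..<Suc v] = v"
      by (simp_all add: hd_upt del: upt_Suc)
    moreover have "vwalk [u..<Suc v] (with_proj (path_graph n))"
      using True assms by (intro vwalk_path_graph_upt) auto
    ultimately show ?thesis by blast
  next
    case False
    then have "hd (rev [v..<Suc u]) = u" "last (rev [v..<Suc u]) = v"
      by (simp_all add: last_rev hd_rev hd_upt del: upt_Suc)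
    moreover have "vwalk (rev [v..<Suc u]) (with_proj (path_graph n))"
      using False assms by (intro vwalk_path_graph_downto) auto
    ultimately show ?thesis by blast
  qed
  then have "?W (LEAST d. ?W d)"
    using LeastI_ex[of ?W] by blast
  then show ?thesis
    unfolding graph_dist_def using vwalk_path_graph_parity by metis
qed

section \<open>Staller's strategy\<close>

lemma parity_less: "(even u \<longleftrightarrow> even v) \<Longrightarrow> u < v \<Longrightarrow> u + 2 \<le> v" for u v :: nat
  by presburger

text \<open>The rank \<open>j\<close> bounds the number of odd vertices inside by
  \<open>2 ^ j\<close>; Staller is to win with at most \<open>j + 1\<close> more moves. The ends
  \<open>0\<close> and \<open>n + 1\<close> are not vertices: they stand for the neighbor that an
  end of the path does not have.\<close>

definition open_gap :: "nat \<Rightarrow> nat list \<Rightarrow> nat \<Rightarrow> nat \<Rightarrow> nat \<Rightarrow> bool" where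
  "open_gap n h j a b \<longleftrightarrow>
     even a \<and> even b \<and> a < b \<and> b \<le> n + 1 \<and> b - a \<le> 2 ^ (j + 1) \<and>
     (\<forall>x. a < x \<and> x < b \<longrightarrow> x \<notin> set h) \<and>
     (a = 0 \<or> a \<in> staller_verts h) \<and> (b = n + 1 \<or> b \<in> staller_verts h)"

text \<open>For even \<open>a\<close> and \<open>b - a = 2 * q\<close> the offset is
  \<open>q\<close> rounded down to an even number, so the new end is even again. For
  \<open>q = 1\<close> this would be \<open>a\<close> itself, and the only interior vertex is taken
  instead.\<close>

definition split_gap :: "nat \<Rightarrow> nat \<Rightarrow> nat" where
  "split_gap a b = (if b = a + 2 then a + 1 else a + 2 * ((b - a) div 4))"

lemma split_gap_between:
  assumes "even a" "even b" "a < b"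
  shows "a < split_gap a b" "split_gap a b < b"
proof -
  have "b = a + 2 \<or> a + 4 \<le> b"
    using assms by presburger
  then show "a < split_gap a b" "split_gap a b < b"
    unfolding split_gap_def by auto
qed

lemma open_gap_mono:
  assumes "open_gap n h j a b" "j \<le> j'"
  shows "open_gap n h j' a b"
proof -
  have "(2 :: nat) ^ (j + 1) \<le> 2 ^ (j' + 1)"
    using assms(2) by (intro power_increasing) auto
  then show ?thesis
    using assms(1) le_trans unfolding open_gap_def by blast
qed

text \<open>Splitting a gap of least rank serves every bound on the rank at once, so that one move
  depending on the history alone suffices.\<close>

lemma exists_gap_strategy:
  "\<exists>\<sigma>. strategy (path_graph n) \<sigma> \<and>
     (\<forall>h j a b. open_gap n h j a b \<longrightarrow> (\<exists>a' b'. open_gap n h j a' b' \<and> \<sigma> h = split_gap a' b'))"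
proof -
  have "\<exists>x. (distinct h \<and> set h \<subset> {1..n} \<longrightarrow> x \<in> {1..n} - set h) \<and>
     (\<forall>j a b. open_gap n h j a b \<longrightarrow> (\<exists>a' b'. open_gap n h j a' b' \<and> x = split_gap a' b'))" for h
  proof (cases "\<exists>j a b. open_gap n h j a b")
    case True
    define k where "k = (LEAST j. \<exists>a b. open_gap n h j a b)"
    from True have "\<exists>a b. open_gap n h k a b"
      unfolding k_def by (rule LeastI_ex)
    then obtain a b where ab: "open_gap n h k a b" by blast
    have "k \<le> j" if "open_gap n h j a' b'" for j a' b'
      unfolding k_def using that by (intro Least_le) blast
    moreover have "split_gap a b \<in> {1..n} - set h"
      using ab split_gap_between[of a b] unfolding open_gap_def by auto
    ultimately show ?thesis
      using ab open_gap_mono by (intro exI[of _ "split_gap a b"]) blast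
  next
    case False
    then show ?thesis by blast
  qed
  then show ?thesis
    unfolding strategy_def pverts_path_graph by metis
qed

lemma open_gap_le: "open_gap n h j a b \<Longrightarrow> a + 2 \<le> b \<and> a + 1 \<le> n"
  using parity_less[of a b] unfolding open_gap_def by auto

text \<open>The vertex \<open>a + 1\<close> is undominated: its closed neighborhood lies between
  \<open>a\<close> and \<open>b\<close>, where the interior is unplayed and each end is Staller's or
  off the path.\<close>

lemma not_dominating_open_gap:
  assumes "open_gap n h j a b" "distinct h"
  shows "\<not> dominating (path_graph n) (dominator_verts h)"
proof -
  have "a + 1 \<in> {1..n}"
    using open_gap_le[OF assms(1)] by simp
  moreover have "closed_nbhd (path_graph n) (a + 1) \<inter> dominator_verts h = {}"
  proof (rule ccontr)
    assume "\<not> ?thesis"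
    then obtain u where u: "u \<in> dominator_verts h" "1 \<le> u" "u \<le> n" "u \<le> a + 2" "a + 1 \<le> u + 1"
      using mem_closed_nbhd_path_graph[OF \<open>a + 1 \<in> {1..n}\<close>] by auto
    moreover have "u \<in> set h" "u \<notin> staller_verts h"
      using u set_eq_staller_Un_dominator[of h] staller_Int_dominator[OF assms(2)] by auto
    moreover have "a + 2 \<le> b"
      using open_gap_le[OF assms(1)] by simp
    moreover have "u = a \<or> (a < u \<and> u < b) \<or> u = b"
      using u \<open>a + 2 \<le> b\<close> by linarith
    ultimately show False
      using assms unfolding open_gap_def by auto
  qed
  ultimately show ?thesis
    unfolding dominating_def by auto
qed

text \<open>A claimed vertex \<open>v\<close> is Staller's own, hence even, and then its neighbor
  \<open>v - 1\<close> is an odd vertex of the path that she lacks.\<close>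

lemma claimed_empty_if_all_even:
  assumes "\<forall>v \<in> staller_verts h. even v"
  shows "claimed (path_graph n) h = {}"
proof (rule ccontr)
  assume "\<not> ?thesis"
  then obtain v where v: "v \<in> {1..n}" and sub: "closed_nbhd (path_graph n) v \<subseteq> staller_verts h"
    unfolding claimed_def by auto
  then have "even v"
    using assms by (auto simp: closed_nbhd_def)
  then have "v - 1 \<in> closed_nbhd (path_graph n) v" "odd (v - 1)"
    using v parity_less[of 0 v] by (auto simp: mem_closed_nbhd_path_graph)
  then show False using assms sub by blast
qed

text \<open>As \<open>n\<close> is odd, an even vertex has two odd neighbors, while Staller holds at
  most one odd vertex, namely \<open>x\<close>.\<close>

lemma claimed_odd_if_one_odd:
  assumes "odd n" "\<forall>v \<in> S. even v" "staller_verts h = insert x S"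
    and v: "v \<in> claimed (path_graph n) h"
  shows "odd v"
proof
  assume "even v"
  have vn: "v \<in> {1..n}" and sub: "closed_nbhd (path_graph n) v \<subseteq> insert x S"
    using v assms(3) unfolding claimed_def by auto
  have "v - 1 \<in> closed_nbhd (path_graph n) v" "v + 1 \<in> closed_nbhd (path_graph n) v"
    using vn \<open>even v\<close> \<open>odd n\<close> parity_less[of 0 v] parity_less[of v "n + 1"]
    by (auto simp: mem_closed_nbhd_path_graph)
  then have "v - 1 \<in> insert x S" "v + 1 \<in> insert x S"
    using sub by blast+
  moreover have "odd (v - 1)" "odd (v + 1)"
    using vn \<open>even v\<close> by auto
  ultimately have "v - 1 = x" "v + 1 = x"
    using assms(2) by blast+
  then show False by simp
qed

text \<open>The \<open>q \<ge> 2\<close> odd vertices of the gap are shared out as floor and ceiling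
  of \<open>q / 2\<close>. Both parts are nonempty, and a bound \<open>2 ^ Suc j'\<close> on
  \<open>q\<close> becomes \<open>2 ^ j'\<close> for each of them.\<close>

lemma open_gap_split:
  assumes gap: "open_gap n h j a b" and "b \<noteq> a + 2" "even (length h)"
  obtains j' where "j = Suc j'" "even (split_gap a b)"
    "open_gap n (h @ [split_gap a b]) j' a (split_gap a b)"
    "open_gap n (h @ [split_gap a b]) j' (split_gap a b) b"
proof -
  define x where "x = split_gap a b"
  obtain c q where c: "a = 2 * c" and q: "b = a + 2 * q"
    using gap unfolding open_gap_def by (metis add_diff_inverse_nat dvd_def dvd_diff_nat not_less_iff_gr_or_eq)
  have "q \<noteq> 0" "q \<noteq> 1"
    using gap q assms(2) unfolding open_gap_def by auto
  then have "2 \<le> q" by simp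
  moreover have "q \<le> 2 ^ j"
    using gap q unfolding open_gap_def by simp
  ultimately have "j \<noteq> 0" by (cases j) auto
  then obtain j' where j': "j = Suc j'"
    by (cases j) auto
  have "(2 * q) div 4 = q div 2"
    by simp
  then have x: "x = a + 2 * (q div 2)"
    unfolding x_def split_gap_def using q assms(2) by simp
  have "even x" "a < x" "x < b"
    using x c q \<open>2 \<le> q\<close> by auto
  moreover have "x - a \<le> 2 ^ (j' + 1)"
    using x \<open>q \<le> 2 ^ j\<close> unfolding j' by simp
  moreover have "q \<le> 2 * 2 ^ j'"
    using \<open>q \<le> 2 ^ j\<close> unfolding j' by simp
  then have "q - q div 2 \<le> 2 ^ j'" by linarith
  then have "b - x \<le> 2 ^ (j' + 1)"
    using x q by simp
  ultimately show ?thesis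
    using gap \<open>even (length h)\<close> j' that
    unfolding x_def[symmetric] open_gap_def
    by (auto simp: staller_verts_snoc)
qed

lemma open_gap_snoc:
  assumes "open_gap n h j a b" "odd (length h)" "\<not> (a < y \<and> y < b)"
  shows "open_gap n (h @ [y]) j a b"
proof -
  have "staller_verts (h @ [y]) = staller_verts h"
    using assms(2) by (simp add: staller_verts_snoc)
  moreover have "x \<notin> set (h @ [y])" if "a < x" "x < b" for x
    using that assms(1,3) unfolding open_gap_def by auto
  ultimately show ?thesis
    using assms(1) unfolding open_gap_def by (simp only: simp_thms) blast
qed

lemma open_gap_unplayed:
  assumes "open_gap n h j a b"
  shows "a + 1 \<in> {1..n} - set h"
proof -
  have "a + 1 < b" "a + 1 \<le> n"
    using open_gap_le[OF assms] by auto
  moreover have "\<forall>x. a < x \<and> x < b \<longrightarrow> x \<notin> set h"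
    using assms unfolding open_gap_def by blast
  ultimately show ?thesis by simp
qed

text \<open>In each round Staller either wins or still has a gap of rank smaller by one after the
  reply, so the sum of rounds played and rank stays at \<open>t + j\<close>. Her vertices before the
  last move are even, which makes every claimed vertex odd.\<close>

lemma gap_strategy_wins:
  assumes "odd n"
    and \<sigma>: "strategy (path_graph n) \<sigma>"
    and gap_\<sigma>: "\<forall>h j a b. open_gap n h j a b \<longrightarrow>
           (\<exists>a' b'. open_gap n h j a' b' \<and> \<sigma> h = split_gap a' b')"
    and \<tau>: "strategy (path_graph n) \<tau>"
    and "open_gap n (s_play \<sigma> \<tau> (2 * t)) j a b"
    and "\<forall>v \<in> staller_verts (s_play \<sigma> \<tau> (2 * t)). even v"
    and "2 * t \<le> n"
    and "\<forall>i<2 * t. \<not> game_over (path_graph n) (s_play \<sigma> \<tau> i)"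
  shows "\<exists>t'\<le>t + j. staller_wins_at (path_graph n) \<sigma> \<tau> (2 * t' + 1) \<and>
           (\<forall>v \<in> claimed (path_graph n) (s_play \<sigma> \<tau> (2 * t' + 1)). odd v)"
  using assms(5-)
proof (induction j arbitrary: t a b rule: less_induct)
  case (less j)
  let ?G = "path_graph n" and ?h = "s_play \<sigma> \<tau> (2 * t)"
  have legal: "distinct (s_play \<sigma> \<tau> m) \<and> set (s_play \<sigma> \<tau> m) \<subseteq> {1..n}" if "m \<le> n" for m
    using s_play_legal[OF _ \<sigma> \<tau>, of m] that by simp
  \<comment> \<open>An open gap contains an unplayed vertex, so there is room for one more
    move.\<close>
  have room: "m + 1 \<le> n" if "m \<le> n" "open_gap n (s_play \<sigma> \<tau> m) j a b" for m j a b
  proof -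
    have "set (s_play \<sigma> \<tau> m) \<subset> {1..n}"
      using legal[OF that(1)] open_gap_unplayed[OF that(2)] by blast
    then have "card (set (s_play \<sigma> \<tau> m)) < n"
      using psubset_card_mono[of "{1..n}"] by simp
    then show ?thesis
      using legal[OF that(1)] by (simp add: distinct_card)
  qed
  have running: "\<not> game_over ?G (s_play \<sigma> \<tau> m)"
    if "m \<le> n" "open_gap n (s_play \<sigma> \<tau> m) j a b" "\<forall>v \<in> staller_verts (s_play \<sigma> \<tau> m). even v"
    for m j a b
    using not_dominating_open_gap[OF that(2)] claimed_empty_if_all_even[OF that(3)] legal[OF that(1)]
    unfolding game_over_def by blast
  \<comment> \<open>The gap that \<open>\<sigma>\<close> splits may differ from the given one; since
    it obeys the same rank bound \<open>j\<close>, it replaces the old ends from here on.\<close>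
  obtain a b where gap: "open_gap n ?h j a b" and \<sigma>_eq: "\<sigma> ?h = split_gap a b"
    using gap_\<sigma> less.prems(1) by blast
  define x where "x = split_gap a b"
  have play1: "s_play \<sigma> \<tau> (2 * t + 1) = ?h @ [x]"
    using \<sigma>_eq by (simp add: x_def)
  have S1: "staller_verts (?h @ [x]) = insert x (staller_verts ?h)"
    by (simp add: staller_verts_snoc)
  have t1: "2 * t + 1 \<le> n"
    using room[OF less.prems(3) gap] by simp
  have over: "\<forall>i<2 * t + 1. \<not> game_over ?G (s_play \<sigma> \<tau> i)"
    using less.prems(4) running[OF less.prems(3) gap less.prems(2)]
    by (metis Suc_eq_plus1 less_Suc_eq)
  show ?case
  proof (cases "b = a + 2")
    case True
    then have x: "x = a + 1" by (simp add: x_def split_gap_def)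
    have an: "a + 1 \<in> {1..n}"
      using gap True unfolding open_gap_def by auto
    \<comment> \<open>The neighbors of \<open>a + 1\<close> are the ends of the gap, each hers or
      off the path.\<close>
    have "closed_nbhd ?G (a + 1) \<subseteq> insert x (staller_verts ?h)"
    proof
      fix u assume "u \<in> closed_nbhd ?G (a + 1)"
      then have "u = a \<or> u = a + 1 \<or> u = b" "1 \<le> u" "u \<le> n"
        using mem_closed_nbhd_path_graph[OF an, of u] True by auto
      then show "u \<in> insert x (staller_verts ?h)"
        using gap x unfolding open_gap_def by auto
    qed
    then have "a + 1 \<in> claimed ?G (?h @ [x])"
      unfolding claimed_def S1 using an by simp
    then have "staller_wins_at ?G \<sigma> \<tau> (2 * t + 1)"
      unfolding staller_wins_at_def play1 using t1 over by auto
    moreover have "\<forall>v \<in> claimed ?G (?h @ [x]). odd v"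
      using claimed_odd_if_one_odd[OF \<open>odd n\<close> less.prems(2) S1] by blast
    ultimately show ?thesis
      using play1 by (intro exI[of _ t]) simp
  next
    case False
    from open_gap_split[OF gap False] obtain j' where j': "j = Suc j'" and "even x"
      and left: "open_gap n (?h @ [x]) j' a x" and right: "open_gap n (?h @ [x]) j' x b"
      unfolding x_def by (metis dvd_triv_left length_s_play)
    define y where "y = \<tau> (?h @ [x])"
    have play2: "s_play \<sigma> \<tau> (2 * (t + 1)) = ?h @ [x] @ [y]"
      using \<sigma>_eq by (simp add: x_def y_def)
    have even1: "\<forall>v \<in> staller_verts (?h @ [x]). even v"
      using less.prems(2) \<open>even x\<close> S1 by auto
    have t2: "2 * (t + 1) \<le> n"
      using room[OF t1, unfolded play1, OF left] by simp
    \<comment> \<open>The two parts are disjoint, so the single reply \<open>y\<close> leaves one of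
      them intact.\<close>
    have gap2: "\<exists>a b. open_gap n (?h @ [x] @ [y]) j' a b"
    proof (cases "a < y \<and> y < x")
      case True
      then show ?thesis
        using open_gap_snoc[OF right, of y] by auto
    next
      case False
      then show ?thesis
        using open_gap_snoc[OF left, of y] by auto
    qed
    have even2: "\<forall>v \<in> staller_verts (?h @ [x] @ [y]). even v"
      using even1 staller_verts_snoc[of "?h @ [x]" y] by simp
    have over2: "\<forall>i<2 * (t + 1). \<not> game_over ?G (s_play \<sigma> \<tau> i)"
    proof (intro allI impI)
      fix i assume "i < 2 * (t + 1)"
      then have "i < 2 * t + 1 \<or> i = 2 * t + 1" by arith
      then show "\<not> game_over ?G (s_play \<sigma> \<tau> i)"
        using over running[OF t1, unfolded play1, OF left even1] play1 by metis
    qed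
    obtain a' b' where "open_gap n (s_play \<sigma> \<tau> (2 * (t + 1))) j' a' b'"
      using gap2 unfolding play2 by blast
    from less.IH[OF _ this _ t2 over2] even2
    obtain t' where "t' \<le> t + 1 + j'" "staller_wins_at ?G \<sigma> \<tau> (2 * t' + 1)"
      "\<forall>v \<in> claimed ?G (s_play \<sigma> \<tau> (2 * t' + 1)). odd v"
      unfolding play2 j' by blast
    then show ?thesis
      unfolding j' by (intro exI[of _ t']) auto
  qed
qed

text \<open>Initially the whole path is a gap of width \<open>n + 1 \<le> 2 ^ (J + 1)\<close>. A win
  at move \<open>2 * t + 1\<close> uses \<open>t + 1\<close> Staller vertices, and an odd vertex is
  at even distance from \<open>1\<close> and from the odd \<open>n\<close>.\<close>

lemma staller_strategy:
  assumes "odd n" "n < 2 ^ (J + 1)"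
  shows "\<exists>\<sigma>. strategy (path_graph n) \<sigma> \<and>
          (\<forall>\<tau>. strategy (path_graph n) \<tau> \<longrightarrow>
             (\<exists>m. staller_wins_at (path_graph n) \<sigma> \<tau> m \<and>
                  card (staller_verts (s_play \<sigma> \<tau> m)) \<le> J + 1 \<and>
                  (\<forall>v \<in> claimed (path_graph n) (s_play \<sigma> \<tau> m).
                      even (graph_dist (path_graph n) v 1) \<and>
                      even (graph_dist (path_graph n) v n))))"
proof -
  obtain \<sigma> where \<sigma>: "strategy (path_graph n) \<sigma>"
    and gap_\<sigma>: "\<forall>h j a b. open_gap n h j a b \<longrightarrow>
           (\<exists>a' b'. open_gap n h j a' b' \<and> \<sigma> h = split_gap a' b')"
    using exists_gap_strategy[of n] by blast
  have start: "open_gap n [] J 0 (n + 1)"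
    using assms unfolding open_gap_def by auto
  have "\<exists>m. staller_wins_at (path_graph n) \<sigma> \<tau> m \<and>
                  card (staller_verts (s_play \<sigma> \<tau> m)) \<le> J + 1 \<and>
                  (\<forall>v \<in> claimed (path_graph n) (s_play \<sigma> \<tau> m).
                      even (graph_dist (path_graph n) v 1) \<and>
                      even (graph_dist (path_graph n) v n))"
    if \<tau>: "strategy (path_graph n) \<tau>" for \<tau>
  proof -
    obtain t where t: "t \<le> J" and win: "staller_wins_at (path_graph n) \<sigma> \<tau> (2 * t + 1)"
      and odd: "\<forall>v \<in> claimed (path_graph n) (s_play \<sigma> \<tau> (2 * t + 1)). odd v"
      using gap_strategy_wins[OF \<open>odd n\<close> \<sigma> gap_\<sigma> \<tau>, of 0 J 0 "n + 1"] start by auto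
    have "distinct (s_play \<sigma> \<tau> (2 * t + 1))"
      using s_play_legal[OF _ \<sigma> \<tau>, of "2 * t + 1"] win unfolding staller_wins_at_def by simp
    then have "card (staller_verts (s_play \<sigma> \<tau> (2 * t + 1))) \<le> J + 1"
      using card_staller_verts[of "s_play \<sigma> \<tau> (2 * t + 1)"] t by (simp del: s_play.simps)
    moreover have "even (graph_dist (path_graph n) v 1) \<and> even (graph_dist (path_graph n) v n)"
      if "v \<in> claimed (path_graph n) (s_play \<sigma> \<tau> (2 * t + 1))" for v
    proof -
      have "v \<in> {1..n}" "odd v"
        using that odd unfolding claimed_def by auto
      then show ?thesis
        using even_graph_dist_path_graph[of v n 1] even_graph_dist_path_graph[of v n n] \<open>odd n\<close>
        by auto
    qed
    ultimately show ?thesis using win by blast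
  qed
  with \<sigma> show ?thesis by blast
qed

section \<open>Dominator's strategy\<close>

text \<open>The set \<open>U\<close> holds the vertices played in \<open>t\<close> rounds and \<open>D\<close> those of Dominator; an
  \<open>i \<in> P\<close> stands for the pair \<open>{i, i + 1}\<close> of unplayed vertices of which Dominator takes one as
  soon as Staller takes the other. The only vertices at risk lie strictly between \<open>a\<close> and
  \<open>b\<close>, and there are none if \<open>a = b\<close>.\<close>

definition dominator_inv ::
  "nat \<Rightarrow> nat \<Rightarrow> nat set \<Rightarrow> nat set \<Rightarrow> nat \<Rightarrow> nat \<Rightarrow> nat set \<Rightarrow> bool" where
  "dominator_inv n t U D a b P \<longleftrightarrow>
     even a \<and> even b \<and> a \<le> b \<and> b \<le> n + 1 \<and> (a < b \<longrightarrow> n + 1 \<le> (b - a) * 2 ^ t) \<and>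
     (\<forall>x. a < x \<and> x < b \<longrightarrow> x \<notin> U) \<and>
     (\<forall>i\<in>P. 1 \<le> i \<and> i + 1 \<le> n \<and> i \<notin> U \<and> i + 1 \<notin> U \<and> i + 1 \<notin> P \<and>
        \<not> (a < i \<and> i < b) \<and> \<not> (a < i + 1 \<and> i + 1 < b)) \<and>
     (\<forall>v. 1 \<le> v \<and> v \<le> n \<longrightarrow>
        a < v \<and> v < b \<or> v \<in> P \<or> v - 1 \<in> P \<or> (\<exists>d\<in>D. d \<le> v + 1 \<and> v \<le> d + 1))"

lemma dominator_inv_init:
  assumes "odd n"
  shows "dominator_inv n 0 {} {} 0 (n + 1) {}"
  using assms unfolding dominator_inv_def by auto

text \<open>Covers the rounds in which Dominator replies inside the endangered interval: it shrinks
  to the part from \<open>a'\<close> to \<open>b'\<close>, and the reply \<open>y\<close> with the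
  new pairs \<open>Q\<close> settles the rest. New pairs cannot overlap old ones, because those in
  \<open>P\<close> avoid the old interval.\<close>

lemma dominator_inv_refine:
  assumes inv: "dominator_inv n t U D a b P"
    and "even a'" "even b'" "a \<le> a'" "a' \<le> b'" "b' \<le> b"
    and "a' < b' \<Longrightarrow> n + 1 \<le> (b' - a') * 2 ^ Suc t"
    and "\<not> (a' < x \<and> x < b')" "\<not> (a' < y \<and> y < b')" "a < y" "y < b"
    and x: "\<And>i. i \<in> P \<Longrightarrow> x \<noteq> i \<and> x \<noteq> i + 1"
    and Q: "\<And>i. i \<in> Q \<Longrightarrow> a < i \<and> i + 1 < b \<and> i \<notin> {x, y} \<and> i + 1 \<notin> {x, y} \<and> i + 1 \<notin> Q \<and>
           \<not> (a' < i \<and> i < b') \<and> \<not> (a' < i + 1 \<and> i + 1 < b')"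
    and cover: "\<And>v. a < v \<Longrightarrow> v < b \<Longrightarrow>
           a' < v \<and> v < b' \<or> v \<in> Q \<or> v - 1 \<in> Q \<or> y \<le> v + 1 \<and> v \<le> y + 1"
  shows "dominator_inv n (Suc t) (insert y (insert x U)) (insert y D) a' b' (P \<union> Q)"
proof -
  have bn: "b \<le> n + 1" and free: "\<And>z. a < z \<Longrightarrow> z < b \<Longrightarrow> z \<notin> U"
    and P: "\<And>i. i \<in> P \<Longrightarrow> 1 \<le> i \<and> i + 1 \<le> n \<and> i \<notin> U \<and> i + 1 \<notin> U \<and> i + 1 \<notin> P \<and>
        \<not> (a < i \<and> i < b) \<and> \<not> (a < i + 1 \<and> i + 1 < b)"
    and V: "\<And>v. 1 \<le> v \<Longrightarrow> v \<le> n \<Longrightarrow>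
        a < v \<and> v < b \<or> v \<in> P \<or> v - 1 \<in> P \<or> (\<exists>d\<in>D. d \<le> v + 1 \<and> v \<le> d + 1)"
    using inv unfolding dominator_inv_def by blast+
  have "z \<notin> insert y (insert x U)" if "a' < z" "z < b'" for z
    using that assms(4,6,8,9) free[of z] by auto
  moreover have "1 \<le> i \<and> i + 1 \<le> n \<and> i \<notin> insert y (insert x U) \<and> i + 1 \<notin> insert y (insert x U) \<and>
      i + 1 \<notin> P \<union> Q \<and> \<not> (a' < i \<and> i < b') \<and> \<not> (a' < i + 1 \<and> i + 1 < b')" if "i \<in> P \<union> Q" for i
  proof (cases "i \<in> Q")
    case True
    have "i + 1 \<notin> P" using P[of "i + 1"] Q[OF True] by auto
    then show ?thesis
      using Q[OF True] bn free[of i] free[of "i + 1"] by auto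
  next
    case False
    then have "i \<in> P" using that by simp
    have "i + 1 \<notin> Q" using P[OF \<open>i \<in> P\<close>] Q[of "i + 1"] by auto
    moreover have "y \<noteq> i" "y \<noteq> i + 1"
      using P[OF \<open>i \<in> P\<close>] \<open>a < y\<close> \<open>y < b\<close> by auto
    moreover have "\<not> (a' < i \<and> i < b')" "\<not> (a' < i + 1 \<and> i + 1 < b')"
      using P[OF \<open>i \<in> P\<close>] assms(4,6) by linarith+
    ultimately show ?thesis
      using P[OF \<open>i \<in> P\<close>] x[OF \<open>i \<in> P\<close>] by auto
  qed
  moreover have "a' < v \<and> v < b' \<or> v \<in> P \<union> Q \<or> v - 1 \<in> P \<union> Q \<or>
      (\<exists>d\<in>insert y D. d \<le> v + 1 \<and> v \<le> d + 1)" if "1 \<le> v" "v \<le> n" for v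
    using V[OF that] cover[of v] by blast
  moreover have "b' \<le> n + 1"
    using bn assms(6) by simp
  ultimately show ?thesis
    unfolding dominator_inv_def using assms(2,3,5,7) by blast
qed

text \<open>Once \<open>y\<close> is played, the vertices of a pair containing \<open>y\<close> are dominated.\<close>

lemma dominator_inv_remove_pair:
  assumes inv: "dominator_inv n t U D a b P"
    and "\<not> (a < x \<and> x < b)" "\<not> (a < y \<and> y < b)"
    and "\<And>i. i \<in> P \<Longrightarrow> x = i \<or> x = i + 1 \<Longrightarrow> y = i \<or> y = i + 1"
  shows "dominator_inv n (Suc t) (insert y (insert x U)) (insert y D) a b
           {i \<in> P. y \<noteq> i \<and> y \<noteq> i + 1}"
proof -
  \<comment> \<open>An unchanged interval keeps its lower bound, as one more round only doubles the
    right-hand side.\<close>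
  have "a < b \<longrightarrow> n + 1 \<le> (b - a) * 2 ^ t"
    using inv unfolding dominator_inv_def by blast
  moreover have "(b - a) * 2 ^ t \<le> (b - a) * 2 ^ Suc t"
    by simp
  ultimately have "a < b \<longrightarrow> n + 1 \<le> (b - a) * 2 ^ Suc t"
    using le_trans by blast
  moreover have "a < v \<and> v < b \<or> v \<in> {i \<in> P. y \<noteq> i \<and> y \<noteq> i + 1} \<or>
      v - 1 \<in> {i \<in> P. y \<noteq> i \<and> y \<noteq> i + 1} \<or> (\<exists>d\<in>insert y D. d \<le> v + 1 \<and> v \<le> d + 1)"
    if "1 \<le> v" "v \<le> n" for v
  proof (cases "y \<le> v + 1 \<and> v \<le> y + 1")
    case False
    have "a < v \<and> v < b \<or> v \<in> P \<or> v - 1 \<in> P \<or> (\<exists>d\<in>D. d \<le> v + 1 \<and> v \<le> d + 1)"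
      using inv that unfolding dominator_inv_def by blast
    moreover have "y \<noteq> v" "y \<noteq> v + 1" "y \<noteq> v - 1" "y \<noteq> v - 1 + 1"
      using False that by auto
    ultimately show ?thesis by blast
  qed blast
  moreover have "z \<notin> insert y (insert x U)" if "a < z" "z < b" for z
    using that inv assms(2,3) unfolding dominator_inv_def by blast
  moreover have "1 \<le> i \<and> i + 1 \<le> n \<and> i \<notin> insert y (insert x U) \<and> i + 1 \<notin> insert y (insert x U) \<and>
      i + 1 \<notin> {i \<in> P. y \<noteq> i \<and> y \<noteq> i + 1} \<and> \<not> (a < i \<and> i < b) \<and> \<not> (a < i + 1 \<and> i + 1 < b)"
    if "i \<in> {i \<in> P. y \<noteq> i \<and> y \<noteq> i + 1}" for i
  proof -
    have i: "i \<in> P" "y \<noteq> i" "y \<noteq> i + 1"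
      using that by auto
    then have "x \<noteq> i" "x \<noteq> i + 1"
      using assms(4)[of i] by auto
    moreover have "1 \<le> i \<and> i + 1 \<le> n \<and> i \<notin> U \<and> i + 1 \<notin> U \<and> i + 1 \<notin> P \<and>
        \<not> (a < i \<and> i < b) \<and> \<not> (a < i + 1 \<and> i + 1 < b)"
      using inv i(1) unfolding dominator_inv_def by blast
    ultimately show ?thesis
      using i by blast
  qed
  moreover have "even a" "even b" "a \<le> b" "b \<le> n + 1"
    using inv unfolding dominator_inv_def by blast+
  ultimately show ?thesis
    unfolding dominator_inv_def by blast
qed

text \<open>A move into a pair is answered by its partner. A move outside pairs and interval, or at
  an odd vertex of the interval, lets Dominator settle the whole interval. After an even move
  inside, the larger part stays endangered; it has at least half the width, which preserves
  \<open>n + 1 \<le> (b - a) * 2 ^ t\<close> for the next \<open>t\<close>.\<close>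

lemma dominator_inv_step:
  assumes inv: "dominator_inv n t U D a b P" and "2 ^ (t + 1) \<le> n"
    and x: "x \<in> {1..n}" "x \<notin> U"
    and z: "z \<in> {1..n}" "z \<notin> insert x U"
  shows "\<exists>y \<in> {1..n} - insert x U. \<exists>a' b' P'.
     dominator_inv n (Suc t) (insert y (insert x U)) (insert y D) a' b' P'"
proof -
  have ab: "even a" "even b" "a \<le> b" "b \<le> n + 1" and pot: "a < b \<Longrightarrow> n + 1 \<le> (b - a) * 2 ^ t"
    and free: "\<And>z. a < z \<Longrightarrow> z < b \<Longrightarrow> z \<notin> U"
    and P: "\<And>i. i \<in> P \<Longrightarrow> 1 \<le> i \<and> i + 1 \<le> n \<and> i \<notin> U \<and> i + 1 \<notin> U \<and> i + 1 \<notin> P \<and>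
        \<not> (a < i \<and> i < b) \<and> \<not> (a < i + 1 \<and> i + 1 < b)"
    using inv unfolding dominator_inv_def by blast+
  consider (pair) i where "i \<in> P" "x = i \<or> x = i + 1"
    | (outside) "\<And>i. i \<in> P \<Longrightarrow> x \<noteq> i \<and> x \<noteq> i + 1" "\<not> (a < x \<and> x < b)"
    | (even) "a < x" "x < b" "even x"
    | (odd) "a < x" "x < b" "odd x"
    by blast
  then show ?thesis
  proof cases
    case pair
    define y where "y = (if x = i then i + 1 else i)"
    have "\<not> (a < x \<and> x < b)" "\<not> (a < y \<and> y < b)" "y \<in> {1..n} - insert x U"
      using P[OF pair(1)] pair(2) by (auto simp: y_def)
    moreover have "y = i' \<or> y = i' + 1" if "i' \<in> P" "x = i' \<or> x = i' + 1" for i'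
    proof -
      have "i' = i"
        using that pair P[of i] P[of i'] by auto
      then show ?thesis by (simp add: y_def)
    qed
    ultimately show ?thesis
      using dominator_inv_remove_pair[OF inv, of x y] by blast
  next
    case outside
    show ?thesis
    proof (cases "a < b")
      case True
      \<comment> \<open>The reply \<open>a + 1\<close> leaves an even number of vertices from
        \<open>a + 2\<close> to \<open>b - 1\<close>, paired off from even \<open>i\<close>. Equal
        ends \<open>a a\<close> mean that nothing is at risk any more.\<close>
      have "dominator_inv n (Suc t) (insert (a + 1) (insert x U)) (insert (a + 1) D) a a
          (P \<union> {i. a + 1 < i \<and> i + 1 < b \<and> even i})"
      proof (rule dominator_inv_refine[OF inv])
        show "a + 1 < b" using True ab parity_less[of a b] by simp
        show "a < v \<and> v < a \<or> v \<in> {i. a + 1 < i \<and> i + 1 < b \<and> even i} \<or>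
            v - 1 \<in> {i. a + 1 < i \<and> i + 1 < b \<and> even i} \<or> a + 1 \<le> v + 1 \<and> v \<le> a + 1 + 1"
          if "a < v" "v < b" for v
          using that ab parity_less[of v b] by (cases "even v") auto
      qed (use outside ab in auto)
      moreover have "a + 1 \<in> {1..n} - insert x U"
        using True ab parity_less[of a b] outside free[of "a + 1"] by auto
      ultimately show ?thesis by blast
    next
      case False
      \<comment> \<open>Nothing is at risk, so any unplayed \<open>z\<close> will do; if it lies in
        a pair, that pair is dissolved.\<close>
      then have "dominator_inv n (Suc t) (insert z (insert x U)) (insert z D) a b
          {i \<in> P. z \<noteq> i \<and> z \<noteq> i + 1}"
        using dominator_inv_remove_pair[OF inv, of x z] outside by auto
      with z show ?thesis by blast
    qed
  next
    case even
    have xP: "x \<noteq> i \<and> x \<noteq> i + 1" if "i \<in> P" for i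
      using P[OF that] even by auto
    have pot: "n + 1 \<le> (b - a) * 2 ^ t" using pot even by simp
    show ?thesis
    proof (cases "x - a \<le> b - x")
      case True
      \<comment> \<open>The reply \<open>x - 1\<close> dominates itself and \<open>x\<close>; the
        vertices from \<open>a + 1\<close> to \<open>x - 2\<close> are paired off from odd
        \<open>i\<close>. The other case is the mirror image.\<close>
      have "dominator_inv n (Suc t) (insert (x - 1) (insert x U)) (insert (x - 1) D) x b
          (P \<union> {i. a < i \<and> i + 1 < x - 1 \<and> odd i})"
      proof (rule dominator_inv_refine[OF inv])
        have "b - a \<le> (b - x) * 2" using True even by linarith
        then have "(b - a) * 2 ^ t \<le> (b - x) * 2 * 2 ^ t"
          by (rule mult_right_mono) simp
        with pot show "n + 1 \<le> (b - x) * 2 ^ Suc t"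
          unfolding power_Suc mult.assoc by (rule le_trans)
        show "a < x - 1" using even ab parity_less[of a x] by simp
        show "x < v \<and> v < b \<or> v \<in> {i. a < i \<and> i + 1 < x - 1 \<and> odd i} \<or>
            v - 1 \<in> {i. a < i \<and> i + 1 < x - 1 \<and> odd i} \<or> x - 1 \<le> v + 1 \<and> v \<le> x - 1 + 1"
          if "a < v" "v < b" for v
          using that even ab parity_less[of a v] by (cases "even v") auto
      qed (use even ab xP in auto)
      moreover have "x - 1 \<in> {1..n} - insert x U"
        using even ab parity_less[of a x] free[of "x - 1"] by auto
      ultimately show ?thesis by blast
    next
      case False
      have "dominator_inv n (Suc t) (insert (x + 1) (insert x U)) (insert (x + 1) D) a x
          (P \<union> {i. x + 1 < i \<and> i + 1 < b \<and> even i})"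
      proof (rule dominator_inv_refine[OF inv])
        have "b - a \<le> (x - a) * 2" using False even by linarith
        then have "(b - a) * 2 ^ t \<le> (x - a) * 2 * 2 ^ t"
          by (rule mult_right_mono) simp
        with pot show "n + 1 \<le> (x - a) * 2 ^ Suc t"
          unfolding power_Suc mult.assoc by (rule le_trans)
        show "x + 1 < b" using even ab parity_less[of x b] by simp
        show "a < v \<and> v < x \<or> v \<in> {i. x + 1 < i \<and> i + 1 < b \<and> even i} \<or>
            v - 1 \<in> {i. x + 1 < i \<and> i + 1 < b \<and> even i} \<or> x + 1 \<le> v + 1 \<and> v \<le> x + 1 + 1"
          if "a < v" "v < b" for v
          using that even ab parity_less[of v b] by (cases "even v") auto
      qed (use even ab xP in auto)
      moreover have "x + 1 \<in> {1..n} - insert x U"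
        using even ab parity_less[of x b] free[of "x + 1"] by auto
      ultimately show ?thesis by blast
    qed
  next
    case odd
    have xP: "x \<noteq> i \<and> x \<noteq> i + 1" if "i \<in> P" for i
      using P[OF that] odd by auto
    \<comment> \<open>The interval has at least two odd vertices; in one of width \<open>2\<close>
      the move \<open>x\<close> might complete a closed neighborhood.\<close>
    have "n + 1 \<le> (b - a) * 2 ^ t"
      using pot odd by simp
    then have "2 ^ (t + 1) < (b - a) * 2 ^ t"
      using assms(2) by linarith
    then have wide: "2 < b - a" by simp
    show ?thesis
    proof (cases "a < x - 1")
      case True
      \<comment> \<open>The vertex \<open>x - 2\<close> stays unpaired but is dominated by the reply
        \<open>x - 1\<close>. Pairs fill \<open>a + 1\<close> to \<open>x - 3\<close> on the left
        and \<open>x + 1\<close> to \<open>b - 1\<close> on the right.\<close>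
      let ?Q = "{i. a < i \<and> i + 1 < x - 1 \<and> odd i} \<union> {i. x < i \<and> i + 1 < b \<and> even i}"
      have "dominator_inv n (Suc t) (insert (x - 1) (insert x U)) (insert (x - 1) D) a a (P \<union> ?Q)"
      proof (rule dominator_inv_refine[OF inv])
        show "a < v \<and> v < a \<or> v \<in> ?Q \<or> v - 1 \<in> ?Q \<or> x - 1 \<le> v + 1 \<and> v \<le> x - 1 + 1"
          if "a < v" "v < b" for v
          using that odd ab parity_less[of a v] parity_less[of v b] parity_less[of x v]
          by (cases "even v"; cases v x rule: linorder_cases) auto
      qed (use odd ab xP True in auto)
      moreover have "x - 1 \<in> {1..n} - insert x U"
        using True odd ab free[of "x - 1"] by auto
      ultimately show ?thesis by blast
    next
      case False
      then have xa: "x = a + 1" using odd by simp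
      \<comment> \<open>Now \<open>x - 1\<close> is the end \<open>a\<close>, so the reply is
        \<open>x + 1\<close>. It dominates \<open>a + 1\<close> to \<open>a + 3\<close>, and pairs
        start at \<open>a + 4\<close>.\<close>
      let ?Q = "{i. x + 2 < i \<and> i + 1 < b \<and> even i}"
      have "dominator_inv n (Suc t) (insert (x + 1) (insert x U)) (insert (x + 1) D) a a (P \<union> ?Q)"
      proof (rule dominator_inv_refine[OF inv])
        show "a < v \<and> v < a \<or> v \<in> ?Q \<or> v - 1 \<in> ?Q \<or> x + 1 \<le> v + 1 \<and> v \<le> x + 1 + 1"
          if "a < v" "v < b" for v
          using that odd ab xa parity_less[of v b] parity_less[of "x + 2" v]
          by (cases "even v") auto
      qed (use odd ab xP xa wide in auto)
      moreover have "x + 1 \<in> {1..n} - insert x U"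
        using xa wide ab free[of "x + 1"] by auto
      ultimately show ?thesis by blast
    qed
  qed
qed

text \<open>Every closed neighborhood contains a vertex of Dominator or two unplayed vertices, and
  the extra move \<open>x\<close> cannot take both. The history \<open>h'\<close> can be the one
  right after \<open>x\<close> or the one after Dominator's reply.\<close>

lemma claimed_empty_if_dominator_inv:
  assumes inv: "dominator_inv n t (set h) (dominator_verts h) a b P" and "2 ^ (t + 1) \<le> n"
    and "distinct h" "set h \<subseteq> {1..n}" "x \<notin> set h"
    and h': "staller_verts h' \<subseteq> insert x (staller_verts h)"
  shows "claimed (path_graph n) h' = {}"
proof (rule ccontr)
  assume "\<not> ?thesis"
  then obtain v where v: "v \<in> {1..n}"
    and "closed_nbhd (path_graph n) v \<subseteq> insert x (staller_verts h)"
    using h' unfolding claimed_def by auto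
  then have sub: "u = x \<or> u \<in> staller_verts h" if "1 \<le> u" "u \<le> n" "u \<le> v + 1" "v \<le> u + 1" for u
    using that mem_closed_nbhd_path_graph[OF v] by blast
  have S: "staller_verts h \<subseteq> set h" "dominator_verts h \<subseteq> set h"
    using set_eq_staller_Un_dominator[of h] by auto
  have disj: "staller_verts h \<inter> dominator_verts h = {}"
    using staller_Int_dominator[OF \<open>distinct h\<close>] .
  have no_pair: False if "i \<notin> set h" "i + 1 \<notin> set h" "1 \<le> i" "i + 1 \<le> n" "v = i \<or> v = i + 1" for i
    using sub[of i] sub[of "i + 1"] that S by auto
  have ab: "even a" "even b" "b \<le> n + 1" and pot: "a < b \<Longrightarrow> n + 1 \<le> (b - a) * 2 ^ t"
    and free: "\<And>z. a < z \<Longrightarrow> z < b \<Longrightarrow> z \<notin> set h"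
    and P: "\<And>i. i \<in> P \<Longrightarrow> 1 \<le> i \<and> i + 1 \<le> n \<and> i \<notin> set h \<and> i + 1 \<notin> set h"
    using inv unfolding dominator_inv_def by blast+
  consider "a < v" "v < b" | "v \<in> P" | "v - 1 \<in> P"
    | d where "d \<in> dominator_verts h" "d \<le> v + 1" "v \<le> d + 1"
    using inv v unfolding dominator_inv_def by auto
  then show False
  proof cases
    case 1
    have "n + 1 \<le> (b - a) * 2 ^ t"
      using pot 1 by simp
    then have "2 ^ (t + 1) < (b - a) * 2 ^ t"
      using assms(2) by linarith
    then have "2 < b - a" by simp
    \<comment> \<open>Inside an interval of width above \<open>2\<close>, \<open>v\<close> has an
      unplayed neighbor that is also inside.\<close>
    then consider "v + 1 < b" | "a < v - 1" using 1 by linarith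
    then show False
    proof cases
      case 1
      then show False
        using no_pair[of v] free[of v] free[of "v + 1"] \<open>a < v\<close> ab by auto
    next
      case 2
      then show False
        using no_pair[of "v - 1"] free[of v] free[of "v - 1"] \<open>v < b\<close> ab by auto
    qed
  next
    case 2
    then show False using P no_pair[of v] by auto
  next
    case 3
    then show False using P[of "v - 1"] no_pair[of "v - 1"] v by auto
  next
    case 4
    then have "d \<in> {1..n}" "d \<noteq> x" "d \<notin> staller_verts h"
      using assms(4,5) S disj by auto
    then show False using sub[of d] 4 by auto
  qed
qed

text \<open>The defence lasts for \<open>J\<close> rounds. Its strategy is fixed before
  \<open>\<sigma>\<close> by looking at the history alone: it restores the invariant
  \<open>I\<close> whenever some unplayed vertex does.\<close>

lemma dominator_strategy:
  assumes "odd n" "2 ^ J \<le> n"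
  shows "\<exists>\<tau>. strategy (path_graph n) \<tau> \<and>
     (\<forall>\<sigma> m. strategy (path_graph n) \<sigma> \<longrightarrow> m \<le> n \<longrightarrow> m \<le> 2 * J \<longrightarrow>
        claimed (path_graph n) (s_play \<sigma> \<tau> m) = {})"
proof -
  define I where
    "I h \<longleftrightarrow> (\<exists>a b P. dominator_inv n (length h div 2) (set h) (dominator_verts h) a b P)" for h
  have "\<exists>y. (distinct h \<and> set h \<subset> {1..n} \<longrightarrow> y \<in> {1..n} - set h) \<and>
     ((\<exists>z \<in> {1..n} - set h. I (h @ [z])) \<longrightarrow> I (h @ [y]))" for h
    by blast
  then obtain \<tau> where \<tau>: "strategy (path_graph n) \<tau>"
    and I_\<tau>: "\<And>h z. z \<in> {1..n} - set h \<Longrightarrow> I (h @ [z]) \<Longrightarrow> I (h @ [\<tau> h])"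
    unfolding strategy_def pverts_path_graph by metis
  have "claimed (path_graph n) (s_play \<sigma> \<tau> m) = {}"
    if \<sigma>: "strategy (path_graph n) \<sigma>" and "m \<le> n" "m \<le> 2 * J" for \<sigma> m
  proof -
    have legal: "distinct (s_play \<sigma> \<tau> m) \<and> set (s_play \<sigma> \<tau> m) \<subseteq> {1..n}" if "m \<le> n" for m
      using s_play_legal[OF _ \<sigma> \<tau>, of m] that by simp
    have pow: "2 ^ (t + 1) \<le> n" if "t + 1 \<le> J" for t
      using power_increasing[OF that, of "2::nat"] assms(2) by simp
    have inv: "I (s_play \<sigma> \<tau> (2 * t))" if "2 * t \<le> n" "t \<le> J" for t
      using that
    proof (induction t)
      case 0
      then show ?case
        using dominator_inv_init[OF \<open>odd n\<close>] by (auto simp: I_def)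
    next
      case (Suc t)
      let ?h = "s_play \<sigma> \<tau> (2 * t)"
      define x where "x = \<sigma> ?h"
      obtain a b P where ih: "dominator_inv n t (set ?h) (dominator_verts ?h) a b P"
        using Suc by (auto simp: I_def)
      have play1: "s_play \<sigma> \<tau> (2 * t + 1) = ?h @ [x]"
        by (simp add: x_def Let_def)
      have legal1: "distinct (?h @ [x])" "set (?h @ [x]) \<subseteq> {1..n}"
        using legal[of "2 * t + 1"] Suc.prems unfolding play1 by auto
      have "card (set (?h @ [x])) < card {1..n}"
        using distinct_card[OF legal1(1)] Suc.prems by simp
      then have "set (?h @ [x]) \<noteq> {1..n}"
        by (metis less_irrefl)
      then have "set (?h @ [x]) \<subset> {1..n}"
        using legal1(2) by (rule psubsetI[rotated])
      then obtain z where "z \<in> {1..n}" "z \<notin> set (?h @ [x])"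
        by blast
      then have z: "z \<in> {1..n}" "z \<notin> insert x (set ?h)"
        by simp_all
      have x: "x \<in> {1..n}" "x \<notin> set ?h"
        using legal1 by auto
      have "t + 1 \<le> J"
        using Suc.prems by simp
      then obtain y a' b' P' where y: "y \<in> {1..n} - insert x (set ?h)"
        and "dominator_inv n (Suc t) (insert y (insert x (set ?h))) (insert y (dominator_verts ?h)) a' b' P'"
        using dominator_inv_step[OF ih pow[OF \<open>t + 1 \<le> J\<close>] x z] by blast
      then have "I ((?h @ [x]) @ [y])"
        unfolding I_def dominator_verts_snoc by (auto simp: insert_commute)
      then have "I ((?h @ [x]) @ [\<tau> (?h @ [x])])"
        using I_\<tau>[of y "?h @ [x]"] y by auto
      then show ?case by (simp add: x_def Let_def)
    qed
    show ?thesis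
    proof (cases "m = 0")
      case True
      then show ?thesis by (auto simp: claimed_def closed_nbhd_def)
    next
      case False
      \<comment> \<open>Position \<open>2 * t\<close> holds Staller's last move among the first
        \<open>m\<close>, so her vertices are the earlier ones and \<open>x\<close>, whether or not
        Dominator has replied.\<close>
      define t where "t = (m - 1) div 2"
      have m: "m = 2 * t + 1 \<or> m = 2 * t + 2"
        using False unfolding t_def by presburger
      let ?h = "s_play \<sigma> \<tau> (2 * t)"
      define x where "x = \<sigma> ?h"
      have tJ: "t + 1 \<le> J" "2 * t + 1 \<le> n"
        using m that by auto
      obtain a b P where i: "dominator_inv n t (set ?h) (dominator_verts ?h) a b P"
        using inv[of t] tJ by (auto simp: I_def)
      have play1: "s_play \<sigma> \<tau> (2 * t + 1) = ?h @ [x]"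
        by (simp add: x_def Let_def)
      have legal1: "distinct ?h" "set ?h \<subseteq> {1..n}" "x \<notin> set ?h"
        using legal[OF tJ(2)] unfolding play1 by auto
      have S1: "staller_verts (?h @ [x]) = insert x (staller_verts ?h)"
        by (simp add: staller_verts_snoc)
      have "staller_verts ((?h @ [x]) @ [y]) = insert x (staller_verts ?h)" for y
        unfolding staller_verts_snoc[of "?h @ [x]"] S1 by simp
      moreover have "s_play \<sigma> \<tau> (2 * t + 2) = (?h @ [x]) @ [\<tau> (?h @ [x])]"
        by (simp add: x_def Let_def)
      ultimately have "staller_verts (s_play \<sigma> \<tau> m) = insert x (staller_verts ?h)"
        using m S1 play1 by metis
      then show ?thesis
        by (intro claimed_empty_if_dominator_inv[OF i pow[OF tJ(1)] legal1]) simp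
    qed
  qed
  with \<tau> show ?thesis by blast
qed

section \<open>The exact value on odd paths from the two bounds\<close>

theorem theorem5p2:
  fixes n :: nat
  assumes "odd n"
  shows "gamma_SMB' (path_graph n) = enat (nat \<lfloor>log 2 (real n)\<rfloor> + 1)
    \<and> (\<exists>\<sigma>. strategy (path_graph n) \<sigma> \<and>
          (\<forall>\<tau>. strategy (path_graph n) \<tau> \<longrightarrow>
             (\<exists>m. staller_wins_at (path_graph n) \<sigma> \<tau> m \<and>
                  card (staller_verts (s_play \<sigma> \<tau> m)) \<le> nat \<lfloor>log 2 (real n)\<rfloor> + 1 \<and>
                  (\<forall>v \<in> claimed (path_graph n) (s_play \<sigma> \<tau> m).
                      even (graph_dist (path_graph n) v 1) \<and>
                      even (graph_dist (path_graph n) v n)))))"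
proof -
  have "n \<ge> 1" using assms by (auto elim!: oddE)
  then obtain J where J: "2 ^ J \<le> n" "n < 2 ^ (J + 1)"
    using ex_power_ivl1[of 2 n] by auto
  have log: "nat \<lfloor>log 2 (real n)\<rfloor> = J"
    using floor_log_nat_eq_if[of 2 J n] J by simp
  \<comment> \<open>With at most \<open>J\<close> Staller vertices a play has at most
    \<open>2 * J\<close> moves, so Dominator's defence covers it.\<close>
  have "\<not> staller_can_win_within (path_graph n) k" if "k \<le> J" for k
  proof
    assume "staller_can_win_within (path_graph n) k"
    then obtain \<sigma> where \<sigma>: "strategy (path_graph n) \<sigma>" and
      win: "\<And>\<tau>. strategy (path_graph n) \<tau> \<Longrightarrow>
        \<exists>m. staller_wins_at (path_graph n) \<sigma> \<tau> m \<and> card (staller_verts (s_play \<sigma> \<tau> m)) \<le> k"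
      unfolding staller_can_win_within_def by blast
    obtain \<tau> where \<tau>: "strategy (path_graph n) \<tau>"
      and safe: "\<And>m. m \<le> n \<Longrightarrow> m \<le> 2 * J \<Longrightarrow> claimed (path_graph n) (s_play \<sigma> \<tau> m) = {}"
      using dominator_strategy[OF assms J(1)] \<sigma> by blast
    obtain m where m: "m \<le> n" "claimed (path_graph n) (s_play \<sigma> \<tau> m) \<noteq> {}"
      and card: "card (staller_verts (s_play \<sigma> \<tau> m)) \<le> k"
      using win[OF \<tau>] unfolding staller_wins_at_def by auto
    have "distinct (s_play \<sigma> \<tau> m)"
      using s_play_legal[OF _ \<sigma> \<tau>, of m] m(1) by simp
    then have "(m + 1) div 2 \<le> J"
      using card_staller_verts[of "s_play \<sigma> \<tau> m"] card that by simp
    then have "m \<le> 2 * J" by linarith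
    then show False using safe m by blast
  qed
  then have lower: "enat (J + 1) \<le> enat k" if "staller_can_win_within (path_graph n) k" for k
    using that by (metis Suc_eq_plus1 enat_ord_simps(1) not_less_eq_eq)
  have upper: "staller_can_win_within (path_graph n) (J + 1)"
    using staller_strategy[OF assms J(2)] unfolding staller_can_win_within_def by blast
  have "gamma_SMB' (path_graph n) = enat (J + 1)"
    unfolding gamma_SMB'_def
  proof (rule antisym)
    show "(INF k \<in> {k. staller_can_win_within (path_graph n) k}. enat k) \<le> enat (J + 1)"
      using upper by (intro INF_lower) simp
    show "enat (J + 1) \<le> (INF k \<in> {k. staller_can_win_within (path_graph n) k}. enat k)"
      using lower by (intro INF_greatest) simp
  qed
  then show ?thesis
    unfolding log using staller_strategy[OF assms J(2)] by blast
qed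

end
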